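(* Let $k\ge 2$ be an integer and let $i\in\{0,\dots,k-1\}$. For a non-negative integer $n$, let $B_{i,k}(n)$ be the number of partitions of $n$ in which each part is either even but $\not\equiv 4i+2 \pmod{4k}$, or odd and $\equiv 2i+1 \text{ or } 2k+2i+1 \pmod{4k}$. Also, let $C_{i,k}(n)$ be the number of partitions of $n$ in which the following hold: if an odd part $2j+1$ is present, then none of the other even parts are equal to any of $2j-2i+2,\, 2j-2i+4,\, \dots,\, 2j+2k-2i-2$, and none of the other odd parts are equal to any of $2j+1,\, 2j+3,\, \dots,\, 2j+2k-1$; and the smallest odd part is at least $2i+1$. Then $B_{i,k}(n) = C_{i,k}(n)$ for all $n$.
   Context: A partition of $n$ is a finite multiset of positive integers (its parts) with sum $n$; the empty partition is the only partition of $0$. "Other" parts are the remaining parts counted with multiplicity after removing one copy of $2j+1$; in particular, no odd part is repeated in a partition counted by $C_{i,k}(n)$. The lists $2j-2i+2, 2j-2i+4,\dots,2j+2k-2i-2$ and $2j+1,2j+3,\dots,2j+2k-1$ increase in steps of $2$. The condition on the smallest odd part means that every odd part is at least $2i+1$ (it is vacuous if there are no odd parts). *)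

theory Defs
  imports "HOL-Library.Multiset" "HOL-Number_Theory.Cong"
begin

definition partitions :: "nat \<Rightarrow> nat multiset set" where
  "partitions n = {p. 0 \<notin># p \<and> \<Sum>\<^sub># p = n}"

(* Guarantees that the cardinalities in B and C below are genuine counts. *)
lemma finite_partitions: "finite (partitions n)"
proof (rule finite_subset)
  show "partitions n \<subseteq> mset ` {xs. set xs \<subseteq> {..n} \<and> length xs \<le> n}"
  proof
    fix p assume "p \<in> partitions n"
    then have p: "0 \<notin># p" "\<Sum>\<^sub># p = n" by (auto simp: partitions_def)
    have size: "0 \<notin># q \<Longrightarrow> size q \<le> \<Sum>\<^sub># q" for q :: "nat multiset"
      by (induction q) auto
    have part: "m \<in># q \<Longrightarrow> m \<le> \<Sum>\<^sub># q" for m and q :: "nat multiset"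
      by (induction q) auto
    obtain xs where xs: "p = mset xs" by (metis ex_mset)
    have "set xs \<subseteq> {..n}" using part[of _ p] p xs by auto
    moreover have "length xs \<le> n" using size[OF p(1)] p xs by simp
    ultimately show "p \<in> mset ` {xs. set xs \<subseteq> {..n} \<and> length xs \<le> n}"
      using xs by auto
  qed
  show "finite (mset ` {xs. set xs \<subseteq> {..n} \<and> length xs \<le> n})"
    using finite_lists_length_le[of "{..n}" n] by simp
qed

definition B :: "nat \<Rightarrow> nat \<Rightarrow> nat \<Rightarrow> nat" where
  "B i k n = card {p \<in> partitions n. \<forall>m \<in># p.
     (even m \<and> \<not> [m = 4 * i + 2] (mod 4 * k)) \<or>
     (odd m \<and> ([m = 2 * i + 1] (mod 4 * k) \<or> [m = 2 * k + 2 * i + 1] (mod 4 * k)))}"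

(* 2j - 2i + 2, 2j - 2i + 4, ..., 2j + 2k - 2i - 2; integers, as the terms may be negative if j < i *)
definition excluded_evens :: "nat \<Rightarrow> nat \<Rightarrow> nat \<Rightarrow> int set" where
  "excluded_evens i k j = (\<lambda>t. 2 * int j - 2 * int i + 2 * int t) ` {1..<k}"

(* 2j + 1, 2j + 3, ..., 2j + 2k - 1 *)
definition excluded_odds :: "nat \<Rightarrow> nat \<Rightarrow> nat set" where
  "excluded_odds k j = (\<lambda>t. 2 * j + 1 + 2 * t) ` {0..<k}"

(* Removing a single copy of 2j + 1 leaves the "other" parts; as 2j + 1 is itself an
   excluded odd value, odd parts cannot be repeated. *)
definition C :: "nat \<Rightarrow> nat \<Rightarrow> nat \<Rightarrow> nat" where
  "C i k n = card {p \<in> partitions n.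
     (\<forall>j. 2 * j + 1 \<in># p \<longrightarrow>
        (\<forall>m \<in># p - {#2 * j + 1#}.
           (even m \<longrightarrow> int m \<notin> excluded_evens i k j) \<and>
           (odd m \<longrightarrow> m \<notin> excluded_odds k j))) \<and>
     (\<forall>m \<in># p. odd m \<longrightarrow> 2 * i + 1 \<le> m)}"

end

theory Submission
  imports Defs "HOL-Computational_Algebra.Formal_Power_Series"
begin

text \<open>Put x = q^2 and z = q^(2i+1). Both generating functions are the generating function of all
  partitions into even parts times a series in z: for B this factor is the product of the
  1 + z x^(kr) over r (pair the factor 1 - z^2 x^(2kr) missing from the even parts with the odd part
  1 - z x^(kr)), and for C it is the sum over k-gapped sets F (an odd part 2j+1 giving j - i in F) of
  the products of z x^e (1 - x^(e+1)) ... (1 - x^(e+k-1)) over e in F. The coefficient of z^m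
  in the latter telescopes: restricted to F below N it has a closed form, which tends to
  x^(k m(m-1)/2) / ((1 - x^k) ... (1 - x^(km))). The product for B expands into the same kind of
  sum with (1, x^k) in place of (k, x), and has the same limit. For a fixed n
  everything is truncated at a large N and compared modulo q^(n+1).\<close>

section \<open>Generating functions of partitions with parts in a given set\<close>

definition parts_in :: "nat set \<Rightarrow> nat \<Rightarrow> nat multiset set" where
  "parts_in A n = {p. set_mset p \<subseteq> A \<and> \<Sum>\<^sub># p = n}"

text \<open>Over a field every series with nonzero constant term is a unit, so denominators can
  later be cancelled in divisibility statements.\<close>

definition pgf :: "nat set \<Rightarrow> rat fps" where
  "pgf A = Abs_fps (\<lambda>n. of_nat (card (parts_in A n)))"

lemma pgf_nth: "fps_nth (pgf A) n = of_nat (card (parts_in A n))"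
  by (simp add: pgf_def)

lemma finite_parts_in: "0 \<notin> A \<Longrightarrow> finite (parts_in A n)"
  by (rule finite_subset[OF _ finite_partitions[of n]]) (auto simp: parts_in_def partitions_def)

text \<open>Deleting one copy of \<open>a\<close> maps the partitions of \<open>n\<close> containing
  \<open>a\<close> bijectively onto all partitions of \<open>n - a\<close> with parts in
  \<open>A\<close>, so these account for \<open>fps_X ^ a * pgf A\<close>. With 0 excluded all sets
  are finite and cardinalities add.\<close>

lemma pgf_remove:
  assumes "a \<in> A" "0 \<notin> A"
  shows "pgf (A - {a}) = pgf A * (1 - fps_X ^ a)"
proof (rule fps_ext)
  fix n
  have split: "parts_in A n = parts_in (A - {a}) n \<union>
    (if n < a then {} else add_mset a ` parts_in A (n - a))" (is "_ = _ \<union> ?S")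
  proof (rule set_eqI)
    fix p
    show "p \<in> parts_in A n \<longleftrightarrow> p \<in> parts_in (A - {a}) n \<union> ?S"
    proof (cases "a \<in># p")
      case True
      then obtain q where "p = add_mset a q" by (meson multi_member_split)
      then show ?thesis using assms by (auto simp: parts_in_def image_iff)
    next
      case False
      then show ?thesis by (auto simp: parts_in_def)
    qed
  qed
  have "finite (parts_in (A - {a}) n)" "finite ?S"
    using assms by (simp_all add: finite_parts_in)
  moreover have "add_mset a q \<notin> parts_in (A - {a}) n" for q
    by (simp add: parts_in_def)
  then have "parts_in (A - {a}) n \<inter> ?S = {}" by auto
  ultimately have "card (parts_in (A - {a}) n \<union> ?S) = card (parts_in (A - {a}) n) + card ?S"
    by (rule card_Un_disjoint)
  then have "card (parts_in A n) = card (parts_in (A - {a}) n) + card ?S"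
    by (simp only: split[symmetric])
  also have "card ?S = (if n < a then 0 else card (parts_in A (n - a)))"
    by (simp add: card_image inj_on_def)
  finally show "fps_nth (pgf (A - {a})) n = fps_nth (pgf A * (1 - fps_X ^ a)) n"
    by (simp add: pgf_nth algebra_simps fps_X_power_mult_right_nth)
qed

lemma pgf_Diff:
  assumes "finite D" "D \<subseteq> A" "0 \<notin> A"
  shows "pgf (A - D) = pgf A * (\<Prod>d\<in>D. 1 - fps_X ^ d)"
  using assms
proof (induction D rule: finite_induct)
  case (insert d D)
  have "pgf (A - insert d D) = pgf ((A - D) - {d})"
    by (metis Diff_insert)
  also have "\<dots> = pgf (A - D) * (1 - fps_X ^ d)"
    using insert by (intro pgf_remove) auto
  finally show ?case using insert by (simp add: mult_ac)
qed auto

section \<open>Weighted sums over k-gapped sets and their closed form\<close>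

definition gapped :: "nat \<Rightarrow> nat set \<Rightarrow> bool" where
  "gapped k F \<longleftrightarrow> (\<forall>a\<in>F. \<forall>b\<in>F. a < b \<longrightarrow> a + k \<le> b)"

definition gapped_sets :: "nat \<Rightarrow> nat \<Rightarrow> nat \<Rightarrow> nat set set" where
  "gapped_sets k m N = {F. F \<subseteq> {..<N} \<and> card F = m \<and> gapped k F}"

text \<open>The power of \<open>x\<close> comes from an odd part, the inner product from the even
  parts it forbids. For \<open>k = 1\<close> the gap condition and the inner product are trivial,
  which leaves the elementary symmetric polynomial of degree \<open>m\<close> in 1, x, ...,
  x^(N-1).\<close>

definition gapped_sum :: "nat \<Rightarrow> 'a::comm_ring_1 \<Rightarrow> nat \<Rightarrow> nat \<Rightarrow> 'a" where
  "gapped_sum k x m N =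
     (\<Sum>F\<in>gapped_sets k m N. \<Prod>e\<in>F. x ^ e * (\<Prod>t\<in>{1..<k}. 1 - x ^ (e + t)))"

lemma finite_gapped_sets: "finite (gapped_sets k m N)"
  by (rule finite_subset[of _ "Pow {..<N}"]) (auto simp: gapped_sets_def)

lemma gapped_sum_0_card [simp]: "gapped_sum k x 0 N = 1"
proof -
  have "F = {}" if "F \<subseteq> {..<N}" "card F = 0" for F :: "nat set"
    using that finite_subset[OF that(1)] by auto
  then have "gapped_sets k 0 N = {{}}"
    by (auto simp: gapped_sets_def gapped_def)
  then show ?thesis by (simp add: gapped_sum_def)
qed

lemma gapped_sum_Suc_0 [simp]: "gapped_sum k x (Suc m) 0 = 0"
proof -
  have "gapped_sets k (Suc m) 0 = {}" by (auto simp: gapped_sets_def)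
  then show ?thesis by (simp add: gapped_sum_def)
qed

text \<open>Split on whether N belongs to the set. If it does, the other elements are at most N - k,
  that is, below \<open>Suc N - k\<close>; for k > N the truncated bound is 0 and correctly leaves
  room for no other element.\<close>

lemma gapped_sets_Suc:
  assumes "k > 0"
  shows "gapped_sets k (Suc m) (Suc N) =
    gapped_sets k (Suc m) N \<union> insert N ` gapped_sets k m (Suc N - k)"
proof (rule set_eqI)
  fix F
  show "F \<in> gapped_sets k (Suc m) (Suc N) \<longleftrightarrow>
    F \<in> gapped_sets k (Suc m) N \<union> insert N ` gapped_sets k m (Suc N - k)" (is "?L \<longleftrightarrow> ?R")
  proof
    assume L: ?L
    show ?R
    proof (cases "N \<in> F")
      case True
      have "finite F" using L finite_subset by (auto simp: gapped_sets_def)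
      moreover have "a < Suc N - k" if "a \<in> F - {N}" for a
      proof -
        have "a < N" using that L by (auto simp: gapped_sets_def less_Suc_eq)
        then have "a + k \<le> N" using that L True by (auto simp: gapped_sets_def gapped_def)
        then show ?thesis by simp
      qed
      ultimately have "F - {N} \<in> gapped_sets k m (Suc N - k)"
        using L True by (auto simp: gapped_sets_def gapped_def)
      moreover have "F = insert N (F - {N})" using True by auto
      ultimately show ?thesis by blast
    next
      case False
      then have "F \<subseteq> {..<N}" using L by (auto simp: gapped_sets_def less_Suc_eq)
      then show ?thesis using L by (auto simp: gapped_sets_def)
    qed
  next
    assume ?R
    then show ?L
    proof
      assume "F \<in> insert N ` gapped_sets k m (Suc N - k)"
      then obtain G where G: "F = insert N G" "G \<subseteq> {..<Suc N - k}" "card G = m" "gapped k G"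
        by (auto simp: gapped_sets_def)
      have "a + k \<le> N" if "a \<in> G" for a using G(2) that by fastforce
      moreover have "finite G" "N \<notin> G"
        using G(2) assms by (auto intro: finite_subset)
      ultimately show ?L using G assms
        by (fastforce simp: gapped_sets_def gapped_def)
    qed (auto simp: gapped_sets_def)
  qed
qed

lemma gapped_sum_Suc:
  assumes "k > 0"
  shows "gapped_sum k x (Suc m) (Suc N) = gapped_sum k x (Suc m) N +
    x ^ N * (\<Prod>t\<in>{1..<k}. 1 - x ^ (N + t)) * gapped_sum k x m (Suc N - k)"
proof -
  let ?w = "\<lambda>F. \<Prod>e\<in>F. x ^ e * (\<Prod>t\<in>{1..<k}. 1 - x ^ (e + t))"
  have notin: "finite G \<and> N \<notin> G" if "G \<in> gapped_sets k m (Suc N - k)" for G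
    using that assms by (auto simp: gapped_sets_def intro: finite_subset)
  have "gapped_sum k x (Suc m) (Suc N) =
      sum ?w (gapped_sets k (Suc m) N) + sum ?w (insert N ` gapped_sets k m (Suc N - k))"
    unfolding gapped_sum_def gapped_sets_Suc[OF assms]
    by (intro sum.union_disjoint) (auto simp: finite_gapped_sets gapped_sets_def)
  also have "sum ?w (insert N ` gapped_sets k m (Suc N - k)) =
      (\<Sum>G\<in>gapped_sets k m (Suc N - k). ?w (insert N G))"
  proof (intro sum.reindex_cong[of "insert N"] inj_onI refl)
    fix G H assume "G \<in> gapped_sets k m (Suc N - k)" "H \<in> gapped_sets k m (Suc N - k)" "insert N G = insert N H"
    then show "G = H" using notin insert_ident by metis
  qed
  also have "\<dots> = (\<Sum>G\<in>gapped_sets k m (Suc N - k).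
      x ^ N * (\<Prod>t\<in>{1..<k}. 1 - x ^ (N + t)) * ?w G)"
    by (intro sum.cong refl) (use notin in \<open>simp add: mult_ac\<close>)
  finally show ?thesis by (simp add: gapped_sum_def sum_distrib_left)
qed

text \<open>The factor for t = 0 vanishes. This settles the cases in which a truncated exponent
  starts at 0.\<close>

lemma prod_zero_base:
  assumes "0 < (l::nat)"
  shows "(\<Prod>t<l. 1 - (x::'a::comm_ring_1) ^ t) = 0"
  using assms by (intro prod_zero) (auto intro!: bexI[of _ 0])

text \<open>For N < (m - 1) k there are no gapped sets; then the truncated subtraction produces the
  vanishing factor 1 - x^0 on the right.\<close>

lemma gapped_sum_closed_form:
  fixes x :: "'a::comm_ring_1"
  assumes "k > 0"
  shows "gapped_sum k x m N * (\<Prod>j=1..m. 1 - x ^ (k * j)) =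
    x ^ (k * (m choose 2)) * (\<Prod>t<m * k. 1 - x ^ (N + k - m * k + t))"
proof (induction m arbitrary: N)
  case 0
  then show ?case by (simp add: numeral_2_eq_2)
next
  case (Suc m)
  let ?D = "\<lambda>m. \<Prod>j=1..m. 1 - x ^ (k * j)"
  show ?case
  proof (induction N)
    case 0
    then show ?case using assms by (simp add: prod_zero_base)
  next
    case (Suc N)
    have IH: "gapped_sum k x m (Suc N - k) * ?D m =
      x ^ (k * (m choose 2)) * (\<Prod>t<m * k. 1 - x ^ (Suc N - m * k + t))"
    \<comment> \<open>The hypothesis yields the exponent (Suc N - k) + k - m * k, which simplifies
      as wanted if k \<le> Suc N. For m = 0 the products are empty; in the remaining case both sides
      contain the factor 1 - x^0.\<close>
    proof (cases "m = 0 \<or> k \<le> Suc N")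
      case True
      then show ?thesis using Suc.IH \<open>\<And>N. gapped_sum k x m N * _ = _\<close>[of "Suc N - k"] by auto
    next
      case False
      then have "Suc N - m * k = 0" "k - m * k = 0" by (cases m; simp)+
      then show ?thesis using False \<open>\<And>N. gapped_sum k x m N * _ = _\<close>[of 0] assms
        by (simp add: prod_zero_base)
    qed
    have "gapped_sum k x (Suc m) (Suc N) * ?D (Suc m) =
      gapped_sum k x (Suc m) N * ?D (Suc m) + x ^ N * (\<Prod>t\<in>{1..<k}. 1 - x ^ (N + t)) *
        (gapped_sum k x m (Suc N - k) * ?D m) * (1 - x ^ (k * Suc m))"
      by (simp add: gapped_sum_Suc[OF assms] algebra_simps)
    also have "\<dots> = x ^ (k * (Suc m choose 2)) * (\<Prod>t<Suc m * k. 1 - x ^ (Suc N + k - Suc m * k + t))"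
    proof (cases "m * k \<le> N")
      case False
      \<comment> \<open>All three products are nonempty and start at exponent 0, so the identity
        reads 0 + 0 = 0.\<close>
      then have "Suc N - m * k = 0" "N + k - Suc m * k = 0" "Suc N + k - Suc m * k = 0" "m * k > 0"
        by (auto intro: gr0I)
      then show ?thesis unfolding IH Suc.IH using assms by (simp add: prod_zero_base)
    next
      case True
      then obtain a where N: "N = a + m * k" using le_Suc_ex by (metis add.commute)
      obtain l where k: "k = Suc l" using assms gr0_implies_Suc by blast
      \<comment> \<open>The factors with exponents from a + 1 to a + (m + 1) k - 1 are common to all
        terms: \<open>low\<close> has one more factor at the bottom, \<open>high\<close> one more at
        the top, and \<open>mid\<close> glues them from the new weight and the induction
        hypothesis.\<close>
      let ?P = "\<Prod>t<m * k + l. 1 - x ^ (Suc a + t)"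
      have len: "Suc m * k = Suc (m * k + l)" by (simp add: k)
      have low: "(\<Prod>t<Suc m * k. 1 - x ^ (a + t)) = (1 - x ^ a) * ?P"
        unfolding len by (subst prod.lessThan_Suc_shift) simp
      have high: "(\<Prod>t<Suc m * k. 1 - x ^ (Suc a + t)) = ?P * (1 - x ^ (a + Suc m * k))"
        unfolding len by simp
      have mid: "(\<Prod>t\<in>{1..<k}. 1 - x ^ (N + t)) * (\<Prod>t<m * k. 1 - x ^ (Suc a + t)) = ?P"
      proof -
        have "(\<Prod>t\<in>{1..<k}. 1 - x ^ (N + t)) = (\<Prod>t<l. 1 - x ^ (Suc a + (m * k + t)))"
          by (rule prod.reindex_bij_witness[of _ Suc "\<lambda>t. t - 1"]) (auto simp: k N add_ac)
        moreover have "?P = (\<Prod>t<m * k. 1 - x ^ (Suc a + t)) * (\<Prod>t<l. 1 - x ^ (Suc a + (m * k + t)))"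
          by (induction l) (simp_all add: mult.assoc)
        ultimately show ?thesis by (simp only: mult.commute)
      qed
      have ch: "k * (Suc m choose 2) = k * (m choose 2) + m * k"
        by (simp add: numeral_2_eq_2 algebra_simps)
      have bases: "Suc N - m * k = Suc a" "N + k - Suc m * k = a" "Suc N + k - Suc m * k = Suc a"
        by (simp_all add: N)
      \<comment> \<open>The telescoping step. Both terms on the left carry the power x^(k (m choose
        2) + m k), by \<open>ch\<close> and by x^N = x^a x^(m k). What is left is (1 - x^a) + x^a (1
        - x^(k (m + 1))) = 1 - x^(a + k (m + 1)).\<close>
      have "x ^ (k * (Suc m choose 2)) * ((1 - x ^ a) * ?P) + x ^ N * ?P * x ^ (k * (m choose 2)) * (1 - x ^ (k * Suc m))
        = x ^ (k * (Suc m choose 2)) * (?P * (1 - x ^ (a + Suc m * k)))"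
        unfolding ch N by (simp only: power_add mult.commute[of k]) (simp add: algebra_simps power_add)
      moreover have "u * (\<Prod>t\<in>{1..<k}. 1 - x ^ (N + t)) * (c * (\<Prod>t<m * k. 1 - x ^ (Suc a + t))) * d =
          u * ?P * c * d" for u c d
        unfolding mid[symmetric] by (simp only: mult_ac)
      ultimately show ?thesis unfolding IH Suc.IH bases low high by (simp only:)
    qed
    finally show ?case .
  qed
qed

text \<open>Group the sets by cardinality, which \<open>z\<close> records. A subset of
  \<open>{..<N}\<close> has at most \<open>N\<close> elements, so the range of \<open>m\<close>
  covers all of them.\<close>

lemma sum_gapped_sum:
  "(\<Sum>m\<le>N. z ^ m * gapped_sum k x m N) =
     (\<Sum>F | F \<subseteq> {..<N} \<and> gapped k F.
        \<Prod>e\<in>F. z * (x ^ e * (\<Prod>t\<in>{1..<k}. 1 - x ^ (e + t))))"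
proof -
  let ?w = "\<lambda>e. x ^ e * (\<Prod>t\<in>{1..<k}. 1 - x ^ (e + t))"
  let ?G = "{F. F \<subseteq> {..<N} \<and> gapped k F}"
  have fin: "finite ?G" by (rule finite_subset[of _ "Pow {..<N}"]) auto
  have card: "card F \<le> N" if "F \<subseteq> {..<N}" for F
    using card_mono[OF _ that] by simp
  have "(\<Sum>F\<in>?G. \<Prod>e\<in>F. z * ?w e) = (\<Sum>m\<le>N. \<Sum>F | F \<in> ?G \<and> card F = m. \<Prod>e\<in>F. z * ?w e)"
    by (rule sum.group[symmetric]) (use fin card in auto)
  also have "\<dots> = (\<Sum>m\<le>N. z ^ m * gapped_sum k x m N)"
    unfolding gapped_sum_def sum_distrib_left gapped_sets_def
    by (intro sum.cong) (auto simp: prod.distrib)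
  finally show ?thesis by simp
qed

section \<open>Comparison of series modulo a power of q\<close>

lemma fps_X_dvd_prod_minus_1:
  assumes "\<And>t. t \<in> I \<Longrightarrow> n \<le> s t"
  shows "fps_X ^ n dvd (\<Prod>t\<in>I. 1 - fps_X ^ s t) - (1 :: rat fps)"
  using assms
proof (induction I rule: infinite_finite_induct)
  case (insert t I)
  let ?P = "\<Prod>t\<in>I. 1 - fps_X ^ s t :: rat fps"
  have "fps_X ^ n dvd (?P - 1) - fps_X ^ s t * ?P"
    using insert by (intro dvd_diff[OF _ dvd_mult2[OF le_imp_power_dvd]]) auto
  moreover have "(?P - 1) - fps_X ^ s t * ?P = (\<Prod>t\<in>insert t I. 1 - fps_X ^ s t) - 1"
    using insert by (simp add: algebra_simps)
  ultimately show ?case by simp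
qed auto

text \<open>The closed forms for (k, q^2) and (1, q^(2k)) have the same denominator and the same
  leading power of q. Their remaining products differ, but all exponents there exceed n, so both are
  1 modulo q^(n+1).\<close>

lemma gapped_sum_agree:
  assumes "k > 0" "m \<le> n" and N: "N = n * k + n + 1"
  shows "fps_X ^ Suc n dvd
    gapped_sum k (fps_X ^ 2 :: rat fps) m N - gapped_sum 1 (fps_X ^ (2 * k)) m N"
proof -
  let ?S = "gapped_sum k (fps_X ^ 2 :: rat fps) m N"
  let ?T = "gapped_sum 1 (fps_X ^ (2 * k) :: rat fps) m N"
  let ?D = "\<Prod>j=1..m. 1 - fps_X ^ (2 * k * j) :: rat fps"
  let ?c = "fps_X ^ (2 * k * (m choose 2)) :: rat fps"
  \<comment> \<open>One formula for both numerators: \<open>?P 1 k\<close> belongs to the sum for k,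
    \<open>?P k 1\<close> to the one for gap 1.\<close>
  let ?P = "\<lambda>k l. \<Prod>t<m * l. 1 - fps_X ^ (2 * k * (N + l - m * l + t)) :: rat fps"
  have "?S * ?D = ?c * ?P 1 k"
    using gapped_sum_closed_form[OF assms(1), of "fps_X ^ 2 :: rat fps" m N]
    by (simp add: mult.assoc flip: power_mult)
  moreover have "?T * ?D = ?c * ?P k 1"
    using gapped_sum_closed_form[of 1 "fps_X ^ (2 * k) :: rat fps" m N]
    by (simp add: mult.assoc flip: power_mult)
  ultimately have "(?S - ?T) * ?D = ?c * ((?P 1 k - 1) - (?P k 1 - 1))"
    by (simp add: algebra_simps)
  moreover have "fps_X ^ Suc n dvd ?P 1 k - 1" "fps_X ^ Suc n dvd ?P k 1 - 1"
  proof -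
    have le: "m * k \<le> n * k" using assms by simp
    have "Suc n \<le> 2 * 1 * (N + k - m * k + t)" for t
    proof -
      \<comment> \<open>This dictates the choice of \<open>N\<close>: up to n * k is subtracted from
        it, and n + 1 must remain.\<close>
      have "m * k + Suc n \<le> N + k" using le N by linarith
      then have "Suc n \<le> N + k - m * k" by linarith
      moreover have "c \<le> 2 * 1 * (c + t)" for c :: nat by simp
      ultimately show ?thesis by (rule order_trans)
    qed
    then show "fps_X ^ Suc n dvd ?P 1 k - 1" by (intro fps_X_dvd_prod_minus_1)
    have "Suc n \<le> 2 * k * (N + 1 - m * 1 + t)" for t
    proof -
      have "n \<le> n * k" using assms by simp
      then have "m + Suc n \<le> N + 1" using assms by linarith
      then have "Suc n \<le> N + 1 - m * 1" by simp
      moreover have "1 * c \<le> 2 * k * (c + t)" for c :: nat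
        using assms by (intro mult_mono) auto
      then have "c \<le> 2 * k * (c + t)" for c :: nat by simp
      ultimately show ?thesis by (rule order_trans)
    qed
    then show "fps_X ^ Suc n dvd ?P k 1 - 1" by (intro fps_X_dvd_prod_minus_1)
  qed
  ultimately have "fps_X ^ Suc n dvd (?S - ?T) * ?D"
    by (metis dvd_mult dvd_diff)
  moreover have "fps_nth ?D 0 = 1"
    using assms by (induction m) auto
  ultimately show ?thesis by (simp add: dvd_mult_unit_iff)
qed

abbreviation Evens :: "nat set" where
  "Evens \<equiv> {m. even m \<and> 0 < m}"

lemma fps_nth_eq_if_dvd:
  assumes "fps_X ^ Suc n dvd f - (g :: rat fps)"
  shows "fps_nth f n = fps_nth g n"
proof -
  obtain h where "f - g = fps_X ^ Suc n * h" using assms by (elim dvdE)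
  then have "fps_nth (f - g) n = 0" by (simp only: fps_X_power_mult_nth) simp
  then show ?thesis by simp
qed

section \<open>The generating function for B\<close>

text \<open>The two odd classes modulo 4k merge into one class modulo 2k, the parity of r telling
  them apart, and the forbidden even parts are exactly the doubles of its members. Since i < k, each
  residue is below 4k, so the members of its class are c + 4kd with natural d.\<close>

lemma residues_iff:
  fixes i k m :: nat
  assumes "i < k"
  shows "[m = 4 * i + 2] (mod 4 * k) \<longleftrightarrow> (\<exists>r. m = 2 * (2 * i + 1 + 2 * k * r))" (is ?even)
    and "[m = 2 * i + 1] (mod 4 * k) \<or> [m = 2 * k + 2 * i + 1] (mod 4 * k) \<longleftrightarrow>
      (\<exists>r. m = 2 * i + 1 + 2 * k * r)" (is ?odd)
proof -
  have res: "[m = c] (mod 4 * k) \<longleftrightarrow> (\<exists>d. m = c + 4 * k * d)" if "c < 4 * k" for c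
  proof
    assume "[m = c] (mod 4 * k)"
    then have "m mod (4 * k) = c" using that by (simp add: cong_def)
    then show "\<exists>d. m = c + 4 * k * d" by (metis mod_mult_div_eq)
  qed (use that in \<open>auto simp: cong_def\<close>)
  have "4 * i + 2 < 4 * k" using assms by simp
  then show ?even by (simp only: res) (simp add: algebra_simps)
  have "(\<exists>d. m = 2 * i + 1 + 4 * k * d) \<or> (\<exists>d. m = 2 * k + 2 * i + 1 + 4 * k * d) \<longleftrightarrow>
    (\<exists>r. m = 2 * i + 1 + 2 * k * r)" (is "?L \<longleftrightarrow> ?R")
  proof
    assume ?L
    then show ?R
    proof (elim disjE exE)
      fix d assume "m = 2 * i + 1 + 4 * k * d"
      then show ?R by (intro exI[of _ "2 * d"]) simp
    next
      fix d assume "m = 2 * k + 2 * i + 1 + 4 * k * d"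
      then show ?R by (intro exI[of _ "2 * d + 1"]) (simp add: algebra_simps)
    qed
  next
    assume ?R
    then obtain r where r: "m = 2 * i + 1 + 2 * k * r" ..
    show ?L
    proof (cases "even r")
      case True
      then show ?thesis using r by (auto elim!: evenE)
    next
      case False
      then show ?thesis using r by (auto elim!: oddE simp: algebra_simps)
    qed
  qed
  then show ?odd using assms by (simp add: res)
qed

text \<open>Allowing an odd part r and forbidding 2r multiplies the series by (1 - q^(2r)) / (1 -
  q^r) = 1 + q^r. Expanding the product of these factors over subsets gives sums with gap 1, as
  every set is 1-gapped.\<close>

lemma B_gf:
  assumes "i < k" "n < N"
  shows "of_nat (B i k n) =
    fps_nth (pgf Evens * (\<Sum>m\<le>N. (fps_X ^ (2 * i + 1)) ^ m * gapped_sum 1 (fps_X ^ (2 * k)) m N)) n"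
proof -
  define g where "g r = 2 * i + 1 + 2 * k * r" for r
  \<comment> \<open>Finitely many odd parts suffice: as g r \<ge> r, an index r \<ge> N > n gives a
    part too large for a partition of n. Hence \<open>A\<close> need agree with the true set of
    parts only up to n.\<close>
  define R where "R = g ` {..<N}"
  define A where "A = (Evens - (*) 2 ` R) \<union> R"
  have "inj g" using assms by (auto simp: g_def inj_on_def)
  have odd_R: "odd r" if "r \<in> R" for r using that by (auto simp: R_def g_def)
  have A0: "0 \<notin> A" using odd_R by (force simp: A_def)
  have g_ge: "r \<le> g r" for r
  proof -
    have "1 * r \<le> 2 * k * r" using assms by (intro mult_right_mono) auto
    then show ?thesis unfolding g_def by linarith
  qed
  have R_iff: "m \<in> R \<longleftrightarrow> (\<exists>r. m = g r)" if "m \<le> n" for m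
  proof
    assume "\<exists>r. m = g r"
    then obtain r where r: "m = g r" ..
    have "r < N" using g_ge[of r] r that assms by linarith
    then show "m \<in> R" using r by (auto simp: R_def)
  qed (auto simp: R_def)
  have twoR_iff: "m \<in> (*) 2 ` R \<longleftrightarrow> (\<exists>r. m = 2 * g r)" if "m \<le> n" for m
  proof
    assume "\<exists>r. m = 2 * g r"
    then obtain r where r: "m = 2 * g r" ..
    then have "g r \<in> R" using R_iff[of "g r"] that by auto
    then show "m \<in> (*) 2 ` R" using r by auto
  qed (auto simp: R_def)
  have part: "m \<le> \<Sum>\<^sub># p" if "m \<in># p" for m and p :: "nat multiset"
    using that by (auto dest!: multi_member_split)
  have mem: "((even m \<and> \<not> [m = 4 * i + 2] (mod 4 * k)) \<or>
     (odd m \<and> ([m = 2 * i + 1] (mod 4 * k) \<or> [m = 2 * k + 2 * i + 1] (mod 4 * k)))) \<longleftrightarrow> m \<in> A"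
    if "m \<le> n" "m > 0" for m
    unfolding residues_iff[OF assms(1)] g_def[symmetric] A_def
    using odd_R R_iff[OF that(1)] twoR_iff[OF that(1)] that(2) by (auto simp: g_def)
  have "{p \<in> partitions n. \<forall>m \<in># p.
     (even m \<and> \<not> [m = 4 * i + 2] (mod 4 * k)) \<or>
     (odd m \<and> ([m = 2 * i + 1] (mod 4 * k) \<or> [m = 2 * k + 2 * i + 1] (mod 4 * k)))} = parts_in A n"
  proof (rule set_eqI, goal_cases)
    case (1 p)
    have "0 \<notin># p \<and> \<Sum>\<^sub># p = n \<Longrightarrow> m \<in># p \<Longrightarrow> m \<le> n \<and> m > 0" for m
      using part[of m p] by (cases m) auto
    then show ?case using mem A0
      unfolding partitions_def parts_in_def mem_Collect_eq subset_iff by metis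
  qed
  then have "of_nat (B i k n) = fps_nth (pgf A) n" by (simp add: B_def pgf_nth)
  also have "pgf A = pgf Evens * (\<Prod>r\<in>R. 1 + fps_X ^ r)"
  proof -
    have fin: "finite R" by (simp add: R_def)
    \<comment> \<open>\<open>pgf_Diff\<close> describes removal only, so \<open>R\<close> is removed
      from \<open>A\<close> rather than added to the remaining even parts.\<close>
    have "A - R = Evens - (*) 2 ` R" using odd_R by (auto simp: A_def)
    then have "pgf A * (\<Prod>r\<in>R. 1 - fps_X ^ r) = pgf (Evens - (*) 2 ` R)"
      using pgf_Diff[of R A] A0 fin by (simp add: A_def)
    also have "\<dots> = pgf Evens * (\<Prod>r\<in>(*) 2 ` R. 1 - fps_X ^ r)"
      using fin odd_pos[OF odd_R] by (intro pgf_Diff) auto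
    also have "(\<Prod>r\<in>(*) 2 ` R. 1 - fps_X ^ r) = (\<Prod>r\<in>R. 1 - (fps_X :: rat fps) ^ (2 * r))"
      by (subst prod.reindex) (auto simp: inj_on_def)
    also have "\<dots> = (\<Prod>r\<in>R. 1 + fps_X ^ r) * (\<Prod>r\<in>R. 1 - fps_X ^ r)"
      unfolding prod.distrib[symmetric]
      by (intro prod.cong refl) (simp add: algebra_simps flip: power_add mult_2)
    finally have eq: "pgf A * (\<Prod>r\<in>R. 1 - fps_X ^ r) =
      pgf Evens * (\<Prod>r\<in>R. 1 + fps_X ^ r) * (\<Prod>r\<in>R. 1 - fps_X ^ r)" by (simp add: mult.assoc)
    have "1 - (fps_X :: rat fps) ^ r \<noteq> 0" if "r \<in> R" for r
    proof
      assume "1 - (fps_X :: rat fps) ^ r = 0"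
      then have "fps_nth (1 - (fps_X :: rat fps) ^ r) 0 = 0" by simp
      moreover have "r \<noteq> 0" using odd_R[OF that] by (cases r) auto
      ultimately show False by simp
    qed
    then have "(\<Prod>r\<in>R. 1 - (fps_X :: rat fps) ^ r) \<noteq> 0"
      using fin by simp
    then show ?thesis using eq by simp
  qed
  also have "(\<Prod>r\<in>R. 1 + fps_X ^ r) = (\<Prod>r<N. fps_X ^ (2 * i + 1) * (fps_X ^ (2 * k)) ^ r + (1 :: rat fps))"
    unfolding R_def using \<open>inj g\<close>
    by (subst prod.reindex) (auto simp: g_def inj_on_def add_ac power_add power_mult mult.assoc)
  also have "\<dots> = (\<Sum>m\<le>N. (fps_X ^ (2 * i + 1)) ^ m * gapped_sum 1 (fps_X ^ (2 * k)) m N)"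
    by (subst prod_add) (auto simp: sum_gapped_sum gapped_def Pow_def intro!: sum.cong)
  finally show ?thesis .
qed


section \<open>The generating function for C\<close>

text \<open>This is 2j + 1 for j = e + i. The shift turns the lower bound 2i + 1 into e \<ge> 0, and
  q to this power is z x^e.\<close>

definition odd_part :: "nat \<Rightarrow> nat \<Rightarrow> nat" where
  "odd_part i e = 2 * e + 2 * i + 1"

text \<open>Even parts excluded by the odd parts whose indices, shifted down by i, form F.\<close>

definition blocked :: "nat \<Rightarrow> nat set \<Rightarrow> nat set" where
  "blocked k F = (\<Union>e\<in>F. (\<lambda>t. 2 * (e + t)) ` {1..<k})"

definition C_partitions :: "nat \<Rightarrow> nat \<Rightarrow> nat \<Rightarrow> nat multiset set" where
  "C_partitions i k n = {p \<in> partitions n.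
     (\<forall>j. 2 * j + 1 \<in># p \<longrightarrow>
        (\<forall>m \<in># p - {#2 * j + 1#}.
           (even m \<longrightarrow> int m \<notin> excluded_evens i k j) \<and>
           (odd m \<longrightarrow> m \<notin> excluded_odds k j))) \<and>
     (\<forall>m \<in># p. odd m \<longrightarrow> 2 * i + 1 \<le> m)}"

lemma inj_odd_part: "inj (odd_part i)"
  by (auto simp: odd_part_def inj_on_def)

lemma odd_odd_part [simp]: "odd (odd_part i e)"
  by (simp add: odd_part_def)

text \<open>For j = e + i the offset i cancels, and the excluded integers become the natural numbers
  2(e + t).\<close>

lemma mem_blocked_iff:
  "m \<in> blocked k F \<longleftrightarrow> (\<exists>e\<in>F. int m \<in> excluded_evens i k (e + i))"
proof -
  have "int m \<in> excluded_evens i k (e + i) \<longleftrightarrow> m \<in> (\<lambda>t. 2 * (e + t)) ` {1..<k}" for e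
    unfolding excluded_evens_def image_iff by (intro bex_cong refl) auto
  then show ?thesis by (auto simp: blocked_def)
qed

text \<open>For k > 0 the case b = a forbids repetition; the cases b > a amount to the gap
  condition.\<close>

lemma mem_excluded_odds_iff:
  "odd_part i b \<in> excluded_odds k (a + i) \<longleftrightarrow> a \<le> b \<and> b < a + k"
proof
  assume "a \<le> b \<and> b < a + k"
  then show "odd_part i b \<in> excluded_odds k (a + i)"
    by (auto simp: excluded_odds_def odd_part_def image_iff intro!: bexI[of _ "b - a"])
qed (auto simp: excluded_odds_def odd_part_def)

text \<open>The odd parts are distinct, so they are coded by a gapped index set \<open>F\<close>;
  the even parts form an arbitrary multiset \<open>q\<close> avoiding the values that
  \<open>F\<close> blocks.\<close>

lemma C_partitions_iff:
  assumes "k > 0"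
  shows "p \<in> C_partitions i k n \<longleftrightarrow> (\<exists>F q. finite F \<and> gapped k F \<and>
    set_mset q \<subseteq> Evens - blocked k F \<and> p = mset_set (odd_part i ` F) + q \<and> \<Sum>\<^sub># p = n)"
    (is "?L \<longleftrightarrow> ?R")
proof
  assume L: ?L
  define F where "F = {e. odd_part i e \<in># p}"
  define q where "q = filter_mset even p"
  have sum: "0 \<notin># p" "\<Sum>\<^sub># p = n" using L by (auto simp: C_partitions_def partitions_def)
  have other: "(even m \<longrightarrow> int m \<notin> excluded_evens i k (e + i)) \<and>
      (odd m \<longrightarrow> m \<notin> excluded_odds k (e + i))"
    if "e \<in> F" "m \<in># p - {#odd_part i e#}" for e m
  proof -
    have "odd_part i e = 2 * (e + i) + 1" by (simp add: odd_part_def)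
    then show ?thesis using L that unfolding C_partitions_def F_def by auto
  qed
  have fin: "finite F"
    using finite_vimageI[OF finite_set_mset[of p] inj_odd_part[of i]] by (simp add: F_def vimage_def)
  have simple: "count p (odd_part i e) = 1" if "e \<in> F" for e
  proof -
    \<comment> \<open>A second copy would be an other part lying in the exclusion list of the
      first.\<close>
    have "odd_part i e \<notin># p - {#odd_part i e#}"
      using other[OF that, of "odd_part i e"] assms by (auto simp: mem_excluded_odds_iff)
    then have "count p (odd_part i e) \<le> 1" by (simp add: not_in_iff)
    moreover have "0 < count p (odd_part i e)" using that by (simp add: F_def)
    ultimately show ?thesis by linarith
  qed
  have gap: "gapped k F"
    unfolding gapped_def
  proof (intro ballI impI)
    fix a b assume ab: "a \<in> F" "b \<in> F" "a < b"
    then have "odd_part i b \<in># p - {#odd_part i a#}"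
      by (auto simp: F_def odd_part_def in_diff_count)
    then have "odd_part i b \<notin> excluded_odds k (a + i)" using other[OF ab(1)] by auto
    then show "a + k \<le> b" using ab(3) by (simp add: mem_excluded_odds_iff)
  qed
  have q: "set_mset q \<subseteq> Evens - blocked k F"
  proof
    fix m assume "m \<in># q"
    then have m: "m \<in># p" "even m" by (auto simp: q_def)
    then have "m \<in># p - {#odd_part i e#}" for e by (auto simp: in_diff_count)
    then have "m \<notin> blocked k F" using other m by (auto simp: mem_blocked_iff[of _ _ _ i])
    then show "m \<in> Evens - blocked k F" using m sum by (auto intro: gr0I)
  qed
  have "p = mset_set (odd_part i ` F) + q"
  proof (rule multiset_eqI)
    fix m
    show "count p m = count (mset_set (odd_part i ` F) + q) m"
    proof (cases "odd m \<and> m \<in># p")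
      case True
      then have "2 * i + 1 \<le> m" using L by (auto simp: C_partitions_def)
      \<comment> \<open>The lower bound on odd parts makes the truncated subtraction exact.\<close>
      then have "m = odd_part i ((m - 2 * i - 1) div 2)"
        using True by (auto simp: odd_part_def elim!: oddE)
      then obtain e where "m = odd_part i e" by blast
      then show ?thesis using True simple[of e] fin
        by (auto simp: F_def q_def count_mset_set')
    next
      case False
      then have "m \<notin> odd_part i ` F" by (auto simp: F_def)
      then show ?thesis using False fin
        by (auto simp: q_def count_mset_set' not_in_iff)
    qed
  qed
  then show ?R using fin gap q sum by blast
next
  assume ?R
  then obtain F q where F: "finite F" "gapped k F" and q: "set_mset q \<subseteq> Evens - blocked k F"
    and p: "p = mset_set (odd_part i ` F) + q" and n: "\<Sum>\<^sub># p = n" by blast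
  have mem: "m \<in># p \<longleftrightarrow> m \<in> odd_part i ` F \<or> m \<in># q" for m
    using F by (simp add: p)
  have "0 \<notin># p" using q by (auto simp: mem odd_part_def)
  moreover have "2 * i + 1 \<le> m" if "m \<in># p" "odd m" for m
    using that q by (auto simp: mem odd_part_def)
  moreover have "(even m \<longrightarrow> int m \<notin> excluded_evens i k j) \<and> (odd m \<longrightarrow> m \<notin> excluded_odds k j)"
    if j: "2 * j + 1 \<in># p" and m: "m \<in># p - {#2 * j + 1#}" for j m
  proof -
    obtain e where e: "e \<in> F" "2 * j + 1 = odd_part i e" using j q by (force simp: mem)
    then have je: "j = e + i" by (simp add: odd_part_def)
    have mp: "m \<in># p" using m by (rule in_diffD)
    show ?thesis
    proof (intro conjI impI)
      assume "even m"
      then have "m \<in># q" using mp by (auto simp: mem)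
      then show "int m \<notin> excluded_evens i k j"
        using q e je mem_blocked_iff[of m k F i] by auto
    next
      assume "odd m"
      then obtain b where b: "b \<in> F" "m = odd_part i b" using mp q by (force simp: mem)
      \<comment> \<open>Since \<open>m\<close> occurs once and survives the removal of
        \<open>2 * j + 1\<close>, it comes from another index.\<close>
      have "count p m = 1"
        using b F q \<open>odd m\<close> by (auto simp: p count_mset_set' not_in_iff[symmetric])
      then have "b \<noteq> e" using m e b by (auto simp: in_diff_count)
      then show "m \<notin> excluded_odds k j"
        unfolding b je mem_excluded_odds_iff using F(2) e b assms by (force simp: gapped_def)
    qed
  qed
  ultimately show ?L using n by (auto simp: C_partitions_def partitions_def)
qed

text \<open>A partition determines \<open>F\<close> by its odd parts and \<open>q\<close> by its
  even parts, so the pairs (F, q) are counted instead. Each index satisfies e \<le>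
  \<open>odd_part i e\<close> \<le> n < N, which bounds \<open>F\<close>.\<close>

lemma card_C_partitions:
  assumes "k > 0" "n < N"
  shows "card (C_partitions i k n) = (\<Sum>F | F \<subseteq> {..<N} \<and> gapped k F.
    card {q. set_mset q \<subseteq> Evens - blocked k F \<and> sum (odd_part i) F + \<Sum>\<^sub># q = n})"
proof -
  let ?G = "{F. F \<subseteq> {..<N} \<and> gapped k F}"
  let ?T = "\<lambda>F. {q. set_mset q \<subseteq> Evens - blocked k F \<and> sum (odd_part i) F + \<Sum>\<^sub># q = n}"
  let ?h = "\<lambda>(F, q). mset_set (odd_part i ` F) + q"
  have sum_h: "\<Sum>\<^sub># (mset_set (odd_part i ` F)) = sum (odd_part i) F" for F
    using sum.reindex[OF inj_on_subset[OF inj_odd_part[of i] subset_UNIV, of F], of id]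
    by (simp add: sum_unfold_sum_mset)
  have finG: "finite F" if "F \<in> ?G" for F using that by (auto intro: finite_subset)
  have "bij_betw ?h (Sigma ?G ?T) (C_partitions i k n)"
  proof (rule bij_betw_imageI)
    have inv: "F = {e. odd_part i e \<in># p} \<and> q = filter_mset even p"
      if "F \<in> ?G" "q \<in> ?T F" "p = mset_set (odd_part i ` F) + q" for F q p
    proof
      have "odd_part i e \<notin># q" for e using that by auto
      then show "F = {e. odd_part i e \<in># p}"
        using that finG inj_odd_part[of i] by (auto simp: inj_image_mem_iff)
      have "{m \<in> odd_part i ` F. even m} = {}" by auto
      then have "filter_mset even (mset_set (odd_part i ` F)) = {#}"
        using finG[OF that(1)] by (simp only: filter_mset_mset_set finite_imageI mset_set.empty)
      moreover have "filter_mset even q = q" using that by (auto simp: filter_mset_eq_conv)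
      ultimately show "q = filter_mset even p" using that by simp
    qed
    show "inj_on ?h (Sigma ?G ?T)"
    proof (rule inj_onI)
      fix u v assume uv: "u \<in> Sigma ?G ?T" "v \<in> Sigma ?G ?T" "?h u = ?h v"
      have "fst w = {e. odd_part i e \<in># ?h w} \<and> snd w = filter_mset even (?h w)"
        if "w \<in> Sigma ?G ?T" for w
      proof (rule inv)
        show "fst w \<in> ?G" "snd w \<in> ?T (fst w)" using that by auto
      qed (simp add: split_beta)
      from this[OF uv(1)] this[OF uv(2)] uv(3) show "u = v" by (simp only: prod_eq_iff)
    qed
    show "?h ` Sigma ?G ?T = C_partitions i k n"
    proof (intro equalityI subsetI)
      fix p assume "p \<in> ?h ` Sigma ?G ?T"
      then obtain F q where "F \<in> ?G" "q \<in> ?T F" "p = mset_set (odd_part i ` F) + q" by auto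
      then show "p \<in> C_partitions i k n"
        unfolding C_partitions_iff[OF assms(1)] using finG by (auto simp: sum_h)
    next
      fix p assume "p \<in> C_partitions i k n"
      then obtain F q where Fq: "finite F" "gapped k F" "set_mset q \<subseteq> Evens - blocked k F"
        "p = mset_set (odd_part i ` F) + q" "\<Sum>\<^sub># p = n"
        unfolding C_partitions_iff[OF assms(1)] by blast
      then have sum: "sum (odd_part i) F + \<Sum>\<^sub># q = n" by (simp add: sum_h)
      have "e < N" if "e \<in> F" for e
      proof -
        have "odd_part i e \<le> sum (odd_part i) F" using that Fq(1) by (intro member_le_sum) auto
        then show ?thesis using sum assms(2) by (simp add: odd_part_def)
      qed
      then have "(F, q) \<in> Sigma ?G ?T" using Fq sum by auto
      then show "p \<in> ?h ` Sigma ?G ?T" using Fq(4) by force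
    qed
  qed
  then have "card (C_partitions i k n) = card (Sigma ?G ?T)" by (simp add: bij_betw_same_card)
  also have "\<dots> = (\<Sum>F\<in>?G. card (?T F))"
  proof (rule card_SigmaI)
    show "finite ?G" by (rule finite_subset[of _ "Pow {..<N}"]) auto
    have "finite (?T F)" for F
    proof (rule finite_subset)
      show "?T F \<subseteq> parts_in (Evens - blocked k F) (n - sum (odd_part i) F)"
        by (auto simp: parts_in_def)
    qed (simp add: finite_parts_in)
    then show "\<forall>F\<in>?G. finite (?T F)" ..
  qed
  finally show ?thesis .
qed

text \<open>For fixed \<open>F\<close> the odd parts contribute a power of q and the blocked even
  parts a finite product; together they form the weight of \<open>F\<close> in the gapped sums, with
  z = q^(2i+1) marking each element.\<close>

lemma C_gf:
  assumes "k > 0" "n < N"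
  shows "of_nat (C i k n) =
    fps_nth (pgf Evens * (\<Sum>m\<le>N. (fps_X ^ (2 * i + 1)) ^ m * gapped_sum k (fps_X ^ 2) m N)) n"
proof -
  have card: "of_nat (card {q. set_mset q \<subseteq> A \<and> w + \<Sum>\<^sub># q = n}) =
    fps_nth (fps_X ^ w * pgf A) n" for A w
  proof (cases "w \<le> n")
    case True
    then have "{q. set_mset q \<subseteq> A \<and> w + \<Sum>\<^sub># q = n} = parts_in A (n - w)"
      by (auto simp: parts_in_def)
    then show ?thesis using True by (simp add: fps_X_power_mult_nth pgf_nth)
  next
    case False
    then have "{q. set_mset q \<subseteq> A \<and> w + \<Sum>\<^sub># q = n} = {}" by auto
    then show ?thesis using False by (simp only: card.empty) (simp add: fps_X_power_mult_nth)
  qed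
  have gf: "fps_X ^ sum (odd_part i) F * pgf (Evens - blocked k F) = pgf Evens *
      (\<Prod>e\<in>F. fps_X ^ (2 * i + 1) * ((fps_X ^ 2) ^ e * (\<Prod>t\<in>{1..<k}. 1 - (fps_X ^ 2) ^ (e + t))))"
    if F: "finite F" "gapped k F" for F
  proof -
    \<comment> \<open>Index a blocks 2(a + 1), ..., 2(a + k - 1). The gap k keeps these blocks
      disjoint, so the product over blocked parts factors over \<open>F\<close>.\<close>
    have "(\<lambda>t. 2 * (a + t)) ` {1..<k} \<inter> (\<lambda>t. 2 * (b + t)) ` {1..<k} = {}"
      if "a \<in> F" "b \<in> F" "a \<noteq> b" for a b
    proof -
      have "a + k \<le> b \<or> b + k \<le> a" using that F(2) by (auto simp: gapped_def neq_iff)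
      then show ?thesis by auto
    qed
    then have "(\<Prod>d\<in>blocked k F. 1 - (fps_X :: rat fps) ^ d) =
        (\<Prod>e\<in>F. \<Prod>d\<in>(\<lambda>t. 2 * (e + t)) ` {1..<k}. 1 - fps_X ^ d)"
      unfolding blocked_def using F(1) by (intro prod.UNION_disjoint) auto
    also have "\<dots> = (\<Prod>e\<in>F. \<Prod>t\<in>{1..<k}. 1 - fps_X ^ (2 * (e + t)))"
      by (rule prod.cong) (auto simp: inj_on_def prod.reindex)
    finally have "(\<Prod>d\<in>blocked k F. 1 - (fps_X :: rat fps) ^ d) =
      (\<Prod>e\<in>F. \<Prod>t\<in>{1..<k}. 1 - (fps_X ^ 2) ^ (e + t))" by (simp only: power_mult)
    moreover have "pgf (Evens - blocked k F) = pgf Evens * (\<Prod>d\<in>blocked k F. 1 - fps_X ^ d)"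
      using F(1) by (intro pgf_Diff) (auto simp: blocked_def)
    moreover have "(fps_X :: rat fps) ^ sum (odd_part i) F =
      (\<Prod>e\<in>F. fps_X ^ (2 * i + 1) * (fps_X ^ 2) ^ e)"
      by (simp add: power_sum odd_part_def mult_ac flip: power_mult power_add power_Suc)
    ultimately show ?thesis by (simp add: prod.distrib mult_ac)
  qed
  have "of_nat (C i k n) = (\<Sum>F | F \<subseteq> {..<N} \<and> gapped k F.
      fps_nth (fps_X ^ sum (odd_part i) F * pgf (Evens - blocked k F)) n)"
    using card_C_partitions[OF assms, of i] by (simp add: C_def C_partitions_def card)
  also have "\<dots> = (\<Sum>F | F \<subseteq> {..<N} \<and> gapped k F. fps_nth (pgf Evens *
      (\<Prod>e\<in>F. fps_X ^ (2 * i + 1) * ((fps_X ^ 2) ^ e * (\<Prod>t\<in>{1..<k}. 1 - (fps_X ^ 2) ^ (e + t))))) n)"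
    by (intro sum.cong refl arg_cong2[of _ _ _ _ fps_nth] gf) (auto intro: finite_subset)
  finally show ?thesis
    by (simp only: sum_gapped_sum sum_distrib_left fps_sum_nth)
qed

section \<open>Equality of the two counts by comparing coefficients\<close>

theorem corollary8:
  fixes i k :: nat
  assumes "k \<ge> 2" and "i \<in> {0..k - 1}"
  shows "\<forall>n. B i k n = C i k n"
proof
  fix n
  have k: "k > 0" and ik: "i < k" using assms by auto
  define N where "N = n * k + n + 1"
  then have nN: "n < N" by simp
  let ?z = "fps_X ^ (2 * i + 1) :: rat fps"
  let ?S = "\<lambda>m. gapped_sum k (fps_X ^ 2 :: rat fps) m N"
  let ?T = "\<lambda>m. gapped_sum 1 (fps_X ^ (2 * k) :: rat fps) m N"
  \<comment> \<open>For m \<le> n the two sums agree modulo q^(n+1); for m > n the factor z^m alone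
    is divisible by it, because (2i + 1) m > n.\<close>
  have "fps_X ^ Suc n dvd ?z ^ m * (?S m - ?T m)" for m
  proof (cases "m \<le> n")
    case True
    then show ?thesis using gapped_sum_agree[OF k _ N_def] by (intro dvd_mult)
  next
    case False
    then have "Suc n \<le> (2 * i + 1) * m" by simp
    then show ?thesis unfolding power_mult[symmetric] by (intro dvd_mult2 le_imp_power_dvd)
  qed
  then have "fps_X ^ Suc n dvd pgf Evens * (\<Sum>m\<le>N. ?z ^ m * (?S m - ?T m))"
    by (intro dvd_mult[OF dvd_sum])
  then have "fps_X ^ Suc n dvd pgf Evens * (\<Sum>m\<le>N. ?z ^ m * ?S m) - pgf Evens * (\<Sum>m\<le>N. ?z ^ m * ?T m)"
    by (simp only: right_diff_distrib sum_subtractf)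
  then have "(of_nat (C i k n) :: rat) = of_nat (B i k n)"
    unfolding C_gf[OF k nN] B_gf[OF ik nN] by (rule fps_nth_eq_if_dvd)
  then show "B i k n = C i k n" by simp
qed

end
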